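(* Let $\mathbb{X}$ be a two-dimensional real polygonal Banach space such that its unit sphere $S_{\mathbb{X}}$ is a regular hexagon. Then $|Ext(B_{\mathbb{L}(\mathbb{X},\mathbb{X})})|=30$.
   Context: All Banach spaces are real. $\mathbb{X}$ is $\mathbb{R}^2$ with a norm whose unit sphere $S_{\mathbb{X}}=\{x:\|x\|=1\}$ is a regular hexagon (necessarily centred at the origin). $\mathbb{L}(\mathbb{X},\mathbb{X})$ is the space of linear operators on $\mathbb{X}$ with the operator norm, $B_{\mathbb{L}(\mathbb{X},\mathbb{X})}$ is its closed unit ball, $Ext(A)$ is the set of extreme points of a convex set $A$, and $|A|$ is the cardinality of $A$. A two-dimensional Banach space is polygonal if its closed unit ball has only finitely many extreme points. *)

theory Defs
  imports "HOL-Analysis.Analysis"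
begin

definition polygonal :: "'a::real_normed_vector itself \<Rightarrow> bool" where
  "polygonal _ \<longleftrightarrow> dim (UNIV :: 'a set) = 2 \<and> finite {x :: 'a. x extreme_point_of cball 0 1}"

definition hexagon_vertex :: "real^2 \<Rightarrow> real \<Rightarrow> real \<Rightarrow> nat \<Rightarrow> real^2" where
  "hexagon_vertex c r t k =
     c + r *\<^sub>R vector [cos (t + real k * pi / 3), sin (t + real k * pi / 3)]"

text \<open>A hexagon is here the closed polygonal curve (not the filled region); its centre \<open>c\<close>,
  circumradius \<open>r\<close> and rotation angle \<open>t\<close> are arbitrary. The indices 0 and 6 denote
  the same vertex, which closes the curve.\<close>

definition regular_hexagon :: "(real^2) set \<Rightarrow> bool" where
  "regular_hexagon S \<longleftrightarrow> (\<exists>c r t. 0 < r \<and>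
     S = (\<Union>k<6. closed_segment (hexagon_vertex c r t k) (hexagon_vertex c r t (Suc k))))"

end

theory Submission imports Defs begin

text \<open>In the basis of two hexagon vertices at angle \<open>2 * pi / 3\<close> the norm is
  \<open>max \<bar>x\<bar> \<bar>y\<bar> \<bar>x - y\<bar>\<close>. Evaluating the three functionals \<open>x\<close>, \<open>-y\<close>, \<open>y - x\<close> at the images of three
  vertices with sum zero identifies operators with real \<open>3 \<times> 3\<close> matrices having zero row and column
  sums, and the unit ball with those matrices whose entries are bounded by 1 in absolute value.
  The non-integral entries of such a matrix never occur alone in a row or column, so if there are any,
  they contain the support of an alternating cycle of \<open>K\<^sub>3\<^sub>,\<^sub>3\<close>, along which the matrix can be perturbed
  in both directions. Hence the extreme points are integral; they turn out to be the 30 nonzero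
  integral matrices in the ball.\<close>

section \<open>Extreme points of symmetric polytopes and of linear images\<close>

text \<open>If all functionals tight at \<open>x\<close> vanish at \<open>d\<close>, a small
  multiple of \<open>d\<close> can be both added to and subtracted from \<open>x\<close>.
  Conversely, a functional tight at \<open>x\<close> is constant on every segment of the polytope
  that has \<open>x\<close> strictly between its ends.\<close>

lemma extreme_point_of_abs_le_iff:
  fixes L :: "('a::real_vector \<Rightarrow> real) set"
  assumes "finite L" and lin: "\<And>f. f \<in> L \<Longrightarrow> linear f"
  shows "x extreme_point_of {x. \<forall>f\<in>L. \<bar>f x\<bar> \<le> 1} \<longleftrightarrow>
    (\<forall>f\<in>L. \<bar>f x\<bar> \<le> 1) \<and> (\<forall>d. (\<forall>f\<in>L. \<bar>f x\<bar> = 1 \<longrightarrow> f d = 0) \<longrightarrow> d = 0)"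
    (is "_ \<longleftrightarrow> ?K x \<and> (\<forall>d. ?tight d \<longrightarrow> d = 0)")
proof (intro iffI conjI allI impI)
  assume ext: "x extreme_point_of {x. \<forall>f\<in>L. \<bar>f x\<bar> \<le> 1}"
  then show K: "?K x" by (simp add: extreme_point_of_def)
  fix d assume d: "?tight d"
  have "\<forall>f\<in>L. \<forall>\<^sub>F e in at_right 0. e * \<bar>f d\<bar> \<le> 1 - \<bar>f x\<bar>"
  proof
    fix f assume f: "f \<in> L"
    show "\<forall>\<^sub>F e in at_right 0. e * \<bar>f d\<bar> \<le> 1 - \<bar>f x\<bar>"
    proof (cases "\<bar>f x\<bar> = 1")
      case False
      then have "0 < 1 - \<bar>f x\<bar>" using K f by force
      moreover have "((\<lambda>e. e * \<bar>f d\<bar>) \<longlongrightarrow> 0 * \<bar>f d\<bar>) (at_right 0)"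
        by (intro tendsto_intros)
      ultimately have "\<forall>\<^sub>F e in at_right 0. e * \<bar>f d\<bar> < 1 - \<bar>f x\<bar>"
        by (intro order_tendstoD(2)) auto
      then show ?thesis by eventually_elim simp
    qed (use d f in auto)
  qed
  \<comment> \<open>As \<open>L\<close> is finite, one positive \<open>e\<close> fits into the slack
    of all constraints at once.\<close>
  then have "\<forall>\<^sub>F e in at_right 0. \<forall>f\<in>L. e * \<bar>f d\<bar> \<le> 1 - \<bar>f x\<bar>"
    using assms(1) by (simp add: eventually_ball_finite)
  then have "\<forall>\<^sub>F e in at_right (0::real). 0 < e \<and> (\<forall>f\<in>L. e * \<bar>f d\<bar> \<le> 1 - \<bar>f x\<bar>)"
    using eventually_at_right_less by (rule eventually_elim2) auto
  then obtain e :: real where e: "0 < e" "\<And>f. f \<in> L \<Longrightarrow> e * \<bar>f d\<bar> \<le> 1 - \<bar>f x\<bar>"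
    using eventually_happens'[OF trivial_limit_at_right_real] by blast
  have "\<bar>f (x + e *\<^sub>R d)\<bar> \<le> 1 \<and> \<bar>f (x - e *\<^sub>R d)\<bar> \<le> 1" if f: "f \<in> L" for f
  proof -
    have "\<bar>e * f d\<bar> \<le> 1 - \<bar>f x\<bar>" using e(2)[OF f] \<open>0 < e\<close> by (simp add: abs_mult)
    then show ?thesis
      using lin[OF f] by (simp add: linear_add linear_diff linear_scale) linarith
  qed
  then have in_K: "x + e *\<^sub>R d \<in> {x. \<forall>f\<in>L. \<bar>f x\<bar> \<le> 1}" "x - e *\<^sub>R d \<in> {x. \<forall>f\<in>L. \<bar>f x\<bar> \<le> 1}"
    by auto
  have "midpoint (x + e *\<^sub>R d) (x - e *\<^sub>R d) = (1 / 2) *\<^sub>R (x + x)"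
    by (simp add: midpoint_def)
  also have "\<dots> = x" by (rule scaleR_half_double)
  finally have mid: "midpoint (x + e *\<^sub>R d) (x - e *\<^sub>R d) = x" .
  have "x \<notin> open_segment (x + e *\<^sub>R d) (x - e *\<^sub>R d)"
    using ext in_K unfolding extreme_point_of_def by blast
  then have "x + e *\<^sub>R d = x - e *\<^sub>R d"
    using midpoint_in_open_segment[of "x + e *\<^sub>R d" "x - e *\<^sub>R d"] unfolding mid by blast
  then have "e *\<^sub>R d = - (e *\<^sub>R d)"
    unfolding diff_conv_add_uminus by (rule add_left_imp_eq)
  then have "2 *\<^sub>R (e *\<^sub>R d) = 0"
    unfolding scaleR_2 by (simp only: eq_neg_iff_add_eq_0)
  then show "d = 0" using \<open>0 < e\<close> by simp
next
  assume asm: "?K x \<and> (\<forall>d. ?tight d \<longrightarrow> d = 0)"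
  show "x extreme_point_of {x. \<forall>f\<in>L. \<bar>f x\<bar> \<le> 1}"
    unfolding extreme_point_of_def
  proof (intro conjI ballI notI)
    fix a b assume a: "a \<in> {x. \<forall>f\<in>L. \<bar>f x\<bar> \<le> 1}" and b: "b \<in> {x. \<forall>f\<in>L. \<bar>f x\<bar> \<le> 1}"
      and "x \<in> open_segment a b"
    then obtain s where "a \<noteq> b" and s: "0 < s" "s < 1" and x: "x = (1 - s) *\<^sub>R a + s *\<^sub>R b"
      by (auto simp: in_segment)
    have "f (b - a) = 0" if f: "f \<in> L" and tight: "\<bar>f x\<bar> = 1" for f
    proof -
      have fx: "f x = (1 - s) * f a + s * f b" and fd: "f (b - a) = f b - f a"
        using lin[OF f] by (simp_all add: x linear_add linear_diff linear_scale)
      have bd: "\<bar>f a\<bar> \<le> 1" "\<bar>f b\<bar> \<le> 1" using a b f by auto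
      consider "f x = 1" | "f x = -1" using tight by linarith
      then show ?thesis
      proof cases
        case 1
        \<comment> \<open>The bound 1 is a weighted mean of \<open>f a\<close> and
          \<open>f b\<close>, neither of which exceeds it, so both attain it.\<close>
        then have *: "(1 - s) * (1 - f a) + s * (1 - f b) = 0"
          using fx by (simp add: algebra_simps)
        have "0 \<le> (1 - s) * (1 - f a)" "0 \<le> s * (1 - f b)" using s bd by auto
        then have "(1 - s) * (1 - f a) = 0" "s * (1 - f b) = 0" using * by linarith+
        then show ?thesis using s fd by simp
      next
        case 2
        then have *: "(1 - s) * (1 + f a) + s * (1 + f b) = 0"
          using fx by (simp add: algebra_simps)
        have "0 \<le> (1 - s) * (1 + f a)" "0 \<le> s * (1 + f b)" using s bd by auto
        then have "(1 - s) * (1 + f a) = 0" "s * (1 + f b) = 0" using * by linarith+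
        then show ?thesis using s fd by simp
      qed
    qed
    then show False using asm \<open>a \<noteq> b\<close> by (metis right_minus_eq)
  qed (use asm in auto)
qed

lemma extreme_points_of_linear_image:
  assumes "linear f" "inj f"
  shows "{y. y extreme_point_of f ` S} = f ` {x. x extreme_point_of S}"
proof -
  have seg: "open_segment (f a) (f b) = f ` open_segment a b" for a b
    using open_segment_linear_image[OF assms] by blast
  have "f x extreme_point_of f ` S \<longleftrightarrow> x extreme_point_of S" for x
    by (simp add: extreme_point_of_def seg inj_image_mem_iff[OF assms(2)])
  moreover have "y \<in> f ` S" if "y extreme_point_of f ` S" for y
    using that by (simp add: extreme_point_of_def)
  ultimately show ?thesis by blast
qed

section \<open>The polytope of matrices with vanishing line sums\<close>

text \<open>Up to signs, the entries of the \<open>3 \<times> 3\<close> matrix of the operator with columns \<open>(a, b)\<close>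
  and \<open>(c, d)\<close>.\<close>

definition entry_forms :: "((real \<times> real) \<times> real \<times> real \<Rightarrow> real) set" where
  "entry_forms = {\<lambda>((a, b), (c, d)). a, \<lambda>((a, b), (c, d)). b, \<lambda>((a, b), (c, d)). a - b,
     \<lambda>((a, b), (c, d)). c, \<lambda>((a, b), (c, d)). d, \<lambda>((a, b), (c, d)). c - d,
     \<lambda>((a, b), (c, d)). a + c, \<lambda>((a, b), (c, d)). b + d, \<lambda>((a, b), (c, d)). a + c - (b + d)}"

text \<open>Four matrix entries serve, up to sign, as free coordinates; the vanishing row and column
  sums determine the other five, so no side conditions remain.\<close>

definition matrix_ball :: "((real \<times> real) \<times> real \<times> real) set" where
  "matrix_ball = {p. \<forall>f\<in>entry_forms. \<bar>f p\<bar> \<le> 1}"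

lemma finite_entry_forms: "finite entry_forms"
  by (simp add: entry_forms_def)

lemma linear_entry_forms: "f \<in> entry_forms \<Longrightarrow> linear f"
  by (auto simp: entry_forms_def linear_iff algebra_simps)

lemma extreme_point_of_matrix_ball_iff:
  "p extreme_point_of matrix_ball \<longleftrightarrow>
    p \<in> matrix_ball \<and> (\<forall>d. (\<forall>f\<in>entry_forms. \<bar>f p\<bar> = 1 \<longrightarrow> f d = 0) \<longrightarrow> d = 0)"
  unfolding matrix_ball_def
  by (subst extreme_point_of_abs_le_iff) (auto simp: finite_entry_forms linear_entry_forms)

lemma int_abs_le_1: "\<bar>real_of_int k\<bar> \<le> 1 \<Longrightarrow> k \<in> {-1, 0, 1}"
  by auto

text \<open>Each disjunction is the support of an alternating cycle: the nine \<open>2 \<times> 2\<close> minors, and the six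
  complements of a permutation.\<close>

lemma line_closed_meeting_cycles:
  assumes cycles:
    "A1 \<or> A2 \<or> B1 \<or> B2" "A1 \<or> A3 \<or> B1 \<or> B3" "A2 \<or> A3 \<or> B2 \<or> B3"
    "A1 \<or> A2 \<or> C1 \<or> C2" "A1 \<or> A3 \<or> C1 \<or> C3" "A2 \<or> A3 \<or> C2 \<or> C3"
    "B1 \<or> B2 \<or> C1 \<or> C2" "B1 \<or> B3 \<or> C1 \<or> C3" "B2 \<or> B3 \<or> C2 \<or> C3"
    "A2 \<or> A3 \<or> B1 \<or> B3 \<or> C1 \<or> C2" "A2 \<or> A3 \<or> B1 \<or> B2 \<or> C1 \<or> C3"
    "A1 \<or> A3 \<or> B2 \<or> B3 \<or> C1 \<or> C2" "A1 \<or> A3 \<or> B1 \<or> B2 \<or> C2 \<or> C3"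
    "A1 \<or> A2 \<or> B2 \<or> B3 \<or> C1 \<or> C3" "A1 \<or> A2 \<or> B1 \<or> B3 \<or> C2 \<or> C3"
  assumes lines:
    "(A3 \<longrightarrow> (A1 \<longleftrightarrow> A2)) \<and> (A1 \<and> A2 \<longrightarrow> A3)"
    "(B3 \<longrightarrow> (B1 \<longleftrightarrow> B2)) \<and> (B1 \<and> B2 \<longrightarrow> B3)"
    "(C3 \<longrightarrow> (C1 \<longleftrightarrow> C2)) \<and> (C1 \<and> C2 \<longrightarrow> C3)"
    "(C1 \<longrightarrow> (A1 \<longleftrightarrow> B1)) \<and> (A1 \<and> B1 \<longrightarrow> C1)"
    "(C2 \<longrightarrow> (A2 \<longleftrightarrow> B2)) \<and> (A2 \<and> B2 \<longrightarrow> C2)"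
    "(C3 \<longrightarrow> (A3 \<longleftrightarrow> B3)) \<and> (A3 \<and> B3 \<longrightarrow> C3)"
  shows "A1 \<and> A2 \<and> B1 \<and> B2"
  \<comment> \<open>Read the atoms as edges of K_{3,3}, rows against columns. By
    \<open>lines\<close> no vertex lies on exactly one false edge, so if any edge were false, the
    false edges would contain a cycle. By \<open>cycles\<close> every cycle has a true edge.\<close>
  using assms by (smt (verit))

text \<open>Tight entries are 1 or -1, hence integral. At an extreme point every nonzero direction
  changes some tight entry, so each alternating cycle runs through an integral entry.\<close>

lemma Ints_matrix_ball_extreme:
  assumes ext: "((a, b), (c, d)) extreme_point_of matrix_ball"
  shows "a \<in> \<int> \<and> b \<in> \<int> \<and> c \<in> \<int> \<and> d \<in> \<int>"
proof -
  have meets_Ints: "\<exists>f\<in>entry_forms. f e \<noteq> 0 \<and> f ((a, b), (c, d)) \<in> \<int>" if "e \<noteq> 0" for e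
  proof -
    have "\<not> (\<forall>f\<in>entry_forms. \<bar>f ((a, b), (c, d))\<bar> = 1 \<longrightarrow> f e = 0)"
      using ext that unfolding extreme_point_of_matrix_ball_iff by blast
    then obtain f where f: "f \<in> entry_forms" "\<bar>f ((a, b), (c, d))\<bar> = 1" "f e \<noteq> 0" by blast
    then have "f ((a, b), (c, d)) \<in> \<int>" by (auto simp: abs_if split: if_splits)
    then show ?thesis using f by (intro bexI[of _ f] conjI)
  qed
  have cycle: "x \<noteq> 0 \<and> a \<in> \<int> \<or> y \<noteq> 0 \<and> b \<in> \<int> \<or> x - y \<noteq> 0 \<and> a - b \<in> \<int> \<or>
      z \<noteq> 0 \<and> c \<in> \<int> \<or> w \<noteq> 0 \<and> d \<in> \<int> \<or> z - w \<noteq> 0 \<and> c - d \<in> \<int> \<or>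
      x + z \<noteq> 0 \<and> a + c \<in> \<int> \<or> y + w \<noteq> 0 \<and> b + d \<in> \<int> \<or>
      x + z - (y + w) \<noteq> 0 \<and> a + c - (b + d) \<in> \<int>"
    if "((x, y), (z, w)) \<noteq> ((0, 0), (0, 0))" for x y z w :: real
  proof -
    have "\<exists>f\<in>entry_forms. f ((x, y), (z, w)) \<noteq> 0 \<and> f ((a, b), (c, d)) \<in> \<int>"
      using that by (intro meets_Ints) (simp add: zero_prod_def)
    then show ?thesis
      by (simp only: entry_forms_def bex_simps prod.case simp_thms)
  qed
  \<comment> \<open>In each row and column one entry is, up to sign, the sum or difference of the
    other two, so a non-integral entry is never alone there.\<close>
  have line: "(x - y \<in> \<int> \<longrightarrow> (x \<in> \<int> \<longleftrightarrow> y \<in> \<int>)) \<and> (x \<in> \<int> \<and> y \<in> \<int> \<longrightarrow> x - y \<in> \<int>)" for x y :: real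
    using Ints_diff[of x "x - y"] Ints_add[of "x - y" y] by auto
  have line': "(x + y \<in> \<int> \<longrightarrow> (x \<in> \<int> \<longleftrightarrow> y \<in> \<int>)) \<and> (x \<in> \<int> \<and> y \<in> \<int> \<longrightarrow> x + y \<in> \<int>)" for x y :: real
    using Ints_diff[of "x + y" x] Ints_diff[of "x + y" y] by auto
  have eq: "(a - b) + (c - d) = a + c - (b + d)" by simp
  \<comment> \<open>Each quadruple has entries 1 and -1 alternating along one cycle and 0 elsewhere.
    The order is that of the disjunctions in \<open>line_closed_meeting_cycles\<close>.\<close>
  note cycles =
    cycle[of 1 1 "-1" "-1"] cycle[of 1 0 "-1" 0] cycle[of 0 1 0 "-1"] cycle[of 1 1 0 0]
    cycle[of 1 0 0 0] cycle[of 0 1 0 0] cycle[of 0 0 1 1] cycle[of 0 0 1 0] cycle[of 0 0 0 1]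
    cycle[of 0 1 1 0] cycle[of 0 1 "-1" "-1"] cycle[of 1 0 0 1] cycle[of 1 0 "-1" "-1"]
    cycle[of 1 1 0 "-1"] cycle[of 1 1 "-1" 0]
  note lines = line[of a b] line[of c d] line[of "a + c" "b + d"]
    line'[of a c] line'[of b d] line'[of "a - b" "c - d", unfolded eq]
  show ?thesis
    by (rule line_closed_meeting_cycles[where ?A1.0 = "a \<in> \<int>" and ?A2.0 = "b \<in> \<int>"
          and ?A3.0 = "a - b \<in> \<int>" and ?B1.0 = "c \<in> \<int>" and ?B2.0 = "d \<in> \<int>"
          and ?B3.0 = "c - d \<in> \<int>" and ?C1.0 = "a + c \<in> \<int>" and ?C2.0 = "b + d \<in> \<int>"
          and ?C3.0 = "a + c - (b + d) \<in> \<int>", OF cycles[simplified] lines])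
qed

section \<open>Integral matrices as extreme points\<close>

text \<open>Integers and an explicit product of 81 candidates make the set executable, so that it
  can be counted by evaluation.\<close>

definition integral_matrices :: "((int \<times> int) \<times> int \<times> int) set" where
  "integral_matrices =
    {p \<in> ({-1, 0, 1} \<times> {-1, 0, 1}) \<times> ({-1, 0, 1} \<times> {-1, 0, 1}). case p of ((a, b), (c, d)) \<Rightarrow>
      {a - b, c - d, a + c, b + d, a + c - (b + d)} \<subseteq> {-1, 0, 1} \<and> ((a, b), (c, d)) \<noteq> ((0, 0), (0, 0))}"

lemma mem_integral_matrices_iff:
  "((a, b), (c, d)) \<in> integral_matrices \<longleftrightarrow>
    {a, b, c, d, a - b, c - d, a + c, b + d, a + c - (b + d)} \<subseteq> {-1, 0, 1} \<and>
    ((a, b), (c, d)) \<noteq> ((0, 0), (0, 0))"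
  unfolding integral_matrices_def mem_Collect_eq mem_Times_iff fst_conv snd_conv prod.case insert_subset
  by (rule iffI; elim conjE; intro conjI; assumption)

text \<open>Evaluation confirms a short count: the support is one of the 9 four-cycles or 6
  six-cycles of K_{3,3}, and each carries two alternating sign patterns.\<close>

lemma card_integral_matrices: "card integral_matrices = 30"
  by code_simp

lemma extreme_points_matrix_ball:
  "{p. p extreme_point_of matrix_ball} =
    map_prod (map_prod of_int of_int) (map_prod of_int of_int) ` integral_matrices" (is "_ = ?R")
proof (intro set_eqI iffI)
  fix p assume "p \<in> {p. p extreme_point_of matrix_ball}"
  moreover obtain a b c d where p: "p = ((a, b), (c, d))" by (metis surj_pair)
  ultimately have ext: "((a, b), (c, d)) extreme_point_of matrix_ball" by simp
  then have ball: "((a, b), (c, d)) \<in> matrix_ball" by (simp add: extreme_point_of_def)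
  obtain a' b' c' d' where int: "a = of_int a'" "b = of_int b'" "c = of_int c'" "d = of_int d'"
    using Ints_matrix_ball_extreme[OF ext] by (auto elim!: Ints_cases)
  \<comment> \<open>No constraint is tight at the zero matrix, so every direction would be
    admissible there.\<close>
  have "((a, b), (c, d)) \<noteq> 0"
  proof
    assume "((a, b), (c, d)) = 0"
    then have "\<forall>e :: (real \<times> real) \<times> real \<times> real. e = 0"
      using ext by (auto simp: extreme_point_of_matrix_ball_iff entry_forms_def zero_prod_def)
    then have "((1, 0), (0, 0)) = (0 :: (real \<times> real) \<times> real \<times> real)" by blast
    then show False by (simp add: zero_prod_def)
  qed
  then have "((a', b'), (c', d')) \<in> integral_matrices"
    using ball int unfolding mem_integral_matrices_iff matrix_ball_def entry_forms_def
    by (simp add: zero_prod_def int_abs_le_1 del: insert_iff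
      flip: of_int_add of_int_diff)
  then show "p \<in> ?R" by (rule rev_image_eqI) (simp add: p int)
next
  fix p assume "p \<in> ?R"
  then obtain q where q: "q \<in> integral_matrices"
    and p: "p = map_prod (map_prod of_int of_int) (map_prod of_int of_int) q"
    by (rule imageE)
  obtain a b c d where "q = ((a, b), (c, d))" by (metis surj_pair)
  then have abcd: "((a, b), (c, d)) \<in> integral_matrices"
    and p: "p = ((of_int a, of_int b), (of_int c, of_int d))"
    using q p by simp_all
  \<comment> \<open>For an integral entry in the ball, being nonzero already means being
    tight.\<close>
  have unit: "\<bar>real_of_int k\<bar> \<le> 1 \<and> (k \<noteq> 0 \<longrightarrow> \<bar>real_of_int k\<bar> = 1)" if "k \<in> {-1, 0, 1}" for k
    using that by auto
  have entries: "a \<in> {-1, 0, 1}" "b \<in> {-1, 0, 1}" "c \<in> {-1, 0, 1}" "d \<in> {-1, 0, 1}"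
    "a - b \<in> {-1, 0, 1}" "c - d \<in> {-1, 0, 1}" "a + c \<in> {-1, 0, 1}" "b + d \<in> {-1, 0, 1}"
    "a + c - (b + d) \<in> {-1, 0, 1}"
    using abcd by (simp_all only: mem_integral_matrices_iff insert_subset)
  note bounds = entries[THEN unit]
  have "p \<in> matrix_ball"
    unfolding p matrix_ball_def entry_forms_def
    using bounds by (simp only: mem_Collect_eq ball_simps prod.case of_int_add of_int_diff simp_thms)
  moreover have "e = 0" if e: "\<forall>f\<in>entry_forms. \<bar>f p\<bar> = 1 \<longrightarrow> f e = 0" for e
  proof -
    obtain x y z w where xyzw: "e = ((x, y), (z, w))" by (metis surj_pair)
    have bars: "(\<bar>real_of_int a\<bar> = 1 \<longrightarrow> x = 0) \<and> (\<bar>real_of_int b\<bar> = 1 \<longrightarrow> y = 0) \<and>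
      (\<bar>real_of_int (a - b)\<bar> = 1 \<longrightarrow> x - y = 0) \<and> (\<bar>real_of_int c\<bar> = 1 \<longrightarrow> z = 0) \<and>
      (\<bar>real_of_int d\<bar> = 1 \<longrightarrow> w = 0) \<and> (\<bar>real_of_int (c - d)\<bar> = 1 \<longrightarrow> z - w = 0) \<and>
      (\<bar>real_of_int (a + c)\<bar> = 1 \<longrightarrow> x + z = 0) \<and> (\<bar>real_of_int (b + d)\<bar> = 1 \<longrightarrow> y + w = 0) \<and>
      (\<bar>real_of_int (a + c - (b + d))\<bar> = 1 \<longrightarrow> x + z - (y + w) = 0)"
      using e unfolding p xyzw entry_forms_def
      by (simp only: ball_simps prod.case of_int_add of_int_diff simp_thms)
    have tight: "k \<noteq> 0 \<longrightarrow> l = 0" if "k \<in> {-1, 0, 1}" "\<bar>real_of_int k\<bar> = 1 \<longrightarrow> l = 0" for k and l :: real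
      using unit[OF that(1)] that(2) by blast
    have zeros: "(a \<noteq> 0 \<longrightarrow> x = 0) \<and> (b \<noteq> 0 \<longrightarrow> y = 0) \<and> (a - b \<noteq> 0 \<longrightarrow> x - y = 0) \<and>
      (c \<noteq> 0 \<longrightarrow> z = 0) \<and> (d \<noteq> 0 \<longrightarrow> w = 0) \<and> (c - d \<noteq> 0 \<longrightarrow> z - w = 0) \<and>
      (a + c \<noteq> 0 \<longrightarrow> x + z = 0) \<and> (b + d \<noteq> 0 \<longrightarrow> y + w = 0) \<and>
      (a + c - (b + d) \<noteq> 0 \<longrightarrow> x + z - (y + w) = 0)"
      using bars by (intro conjI tight entries) iprover+
    \<comment> \<open>A row with a nonzero entry has two of them, since its sum is zero; so \<open>e\<close> vanishes on it.\<close>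
    have row: "(k = 0 \<and> l = 0) \<or> (s = 0 \<and> t = 0)"
      if "k \<noteq> 0 \<longrightarrow> s = 0" "l \<noteq> 0 \<longrightarrow> t = 0" "k - l \<noteq> 0 \<longrightarrow> s - t = 0" for k l :: int and s t :: real
      using that by (cases "k = 0"; cases "l = 0") auto
    have "(a = 0 \<and> b = 0) \<or> (x = 0 \<and> y = 0)"
      using zeros by (intro row) iprover+
    moreover have "(c = 0 \<and> d = 0) \<or> (z = 0 \<and> w = 0)"
      using zeros by (intro row) iprover+
    moreover have "(a + c = 0 \<and> b + d = 0) \<or> (x + z = 0 \<and> y + w = 0)"
      using zeros by (intro row) iprover+
    moreover have "a \<noteq> 0 \<or> b \<noteq> 0 \<or> c \<noteq> 0 \<or> d \<noteq> 0"
      using abcd by (simp add: mem_integral_matrices_iff)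
    \<comment> \<open>Since the columns sum to zero, a nonzero matrix has at least two nonzero rows.
      There \<open>e\<close> vanishes, and hence also on the third row.\<close>
    ultimately have "x = 0 \<and> y = 0 \<and> z = 0 \<and> w = 0"
      by (smt (verit))
    then show ?thesis by (simp add: xyzw zero_prod_def)
  qed
  ultimately show "p \<in> {p. p extreme_point_of matrix_ball}"
    by (simp add: extreme_point_of_matrix_ball_iff)
qed

section \<open>Operators on a plane with a hexagonal norm\<close>

text \<open>The unit ball is the hexagon with vertices \<open>u\<close>, \<open>u + v\<close>,
  \<open>v\<close> and their negatives. Linear independence of \<open>u\<close> and \<open>v\<close>
  follows from \<open>norm_eq\<close>.\<close>

locale hexagonal_basis =
  fixes u v :: "'a::real_normed_vector"
  assumes spans: "\<exists>x y. z = x *\<^sub>R u + y *\<^sub>R v"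
    and norm_eq: "norm (x *\<^sub>R u + y *\<^sub>R v) = max (max \<bar>x\<bar> \<bar>y\<bar>) \<bar>x - y\<bar>"
begin

lemma unique:
  assumes "x *\<^sub>R u + y *\<^sub>R v = x' *\<^sub>R u + y' *\<^sub>R v"
  shows "x = x' \<and> y = y'"
proof -
  have "(x - x') *\<^sub>R u + (y - y') *\<^sub>R v = 0"
    using assms by (simp add: algebra_simps)
  then show ?thesis using norm_eq[of "x - x'" "y - y'"] by auto
qed

definition coord :: "'a \<Rightarrow> real \<times> real" where
  "coord z = (SOME p. z = fst p *\<^sub>R u + snd p *\<^sub>R v)"

lemma coord_expand: "fst (coord z) *\<^sub>R u + snd (coord z) *\<^sub>R v = z"
  unfolding coord_def using spans[of z] by (metis (mono_tags, lifting) fst_conv snd_conv someI_ex)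

lemma coord_eq: "coord (x *\<^sub>R u + y *\<^sub>R v) = (x, y)"
  using unique[OF coord_expand] by (simp add: prod_eq_iff)

lemma norm_le_1_iff:
  "norm (x *\<^sub>R u + y *\<^sub>R v) \<le> 1 \<longleftrightarrow> \<bar>x\<bar> \<le> 1 \<and> \<bar>y\<bar> \<le> 1 \<and> \<bar>x - y\<bar> \<le> 1"
  by (auto simp: norm_eq)

lemma linear_coord: "linear coord"
proof (rule linearI)
  fix z w r
  have "z + w = (fst (coord z) + fst (coord w)) *\<^sub>R u + (snd (coord z) + snd (coord w)) *\<^sub>R v"
    by (subst (1) coord_expand[of z, symmetric], subst (1) coord_expand[of w, symmetric])
      (simp add: algebra_simps)
  then show "coord (z + w) = coord z + coord w"
    by (metis coord_eq plus_prod_def)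
  have "r *\<^sub>R z = (r * fst (coord z)) *\<^sub>R u + (r * snd (coord z)) *\<^sub>R v"
    by (subst (1) coord_expand[of z, symmetric]) (simp add: algebra_simps)
  then show "coord (r *\<^sub>R z) = r *\<^sub>R coord z"
    by (metis coord_eq scaleR_prod_def real_scaleR_def)
qed

text \<open>It suffices to bound an operator at the vertices, because a point of the cone over an edge is a
  combination of the two ends whose nonnegative coefficients add up to the norm of the point.\<close>

lemma norm_blinfun_le_1_iff:
  fixes T :: "'a \<Rightarrow>\<^sub>L 'b::real_normed_vector"
  shows "norm T \<le> 1 \<longleftrightarrow> norm (T u) \<le> 1 \<and> norm (T v) \<le> 1 \<and> norm (T u + T v) \<le> 1"
proof
  assume T: "norm T \<le> 1"
  have T_le: "norm (T z) \<le> 1" if "norm z \<le> 1" for z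
    using norm_blinfun[of T z] T that mult_le_one[of "norm T" "norm z"] by fastforce
  show "norm (T u) \<le> 1 \<and> norm (T v) \<le> 1 \<and> norm (T u + T v) \<le> 1"
    using T_le[of u] T_le[of v] T_le[of "u + v"]
      norm_eq[of 1 0] norm_eq[of 0 1] norm_eq[of 1 1]
    by (simp add: blinfun.add_right)
next
  assume T: "norm (T u) \<le> 1 \<and> norm (T v) \<le> 1 \<and> norm (T u + T v) \<le> 1"
  have comb: "norm (s *\<^sub>R p + t *\<^sub>R q) \<le> \<bar>s\<bar> + \<bar>t\<bar>" if "norm p \<le> 1" "norm q \<le> 1" for s t :: real and p q :: 'b
    using norm_triangle_ineq[of "s *\<^sub>R p" "t *\<^sub>R q"] mult_left_mono[OF that(1), of "\<bar>s\<bar>"]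
      mult_left_mono[OF that(2), of "\<bar>t\<bar>"] by simp
  let ?m = "\<lambda>x y :: real. max (max \<bar>x\<bar> \<bar>y\<bar>) \<bar>x - y\<bar>"
  have bound: "norm (x *\<^sub>R T u + y *\<^sub>R T v) \<le> ?m x y" for x y
  proof -
    have "norm (x *\<^sub>R T u + y *\<^sub>R T v) \<le> \<bar>x\<bar> + \<bar>y\<bar>"
      using comb T by blast
    moreover have "norm (x *\<^sub>R T u + y *\<^sub>R T v) \<le> \<bar>x - y\<bar> + \<bar>y\<bar>"
    proof -
      have "x *\<^sub>R T u + y *\<^sub>R T v = (x - y) *\<^sub>R T u + y *\<^sub>R (T u + T v)"
        by (simp add: algebra_simps)
      then show ?thesis using comb[of "T u" "T u + T v" "x - y" y] T by metis
    qed
    moreover have "norm (x *\<^sub>R T u + y *\<^sub>R T v) \<le> \<bar>y - x\<bar> + \<bar>x\<bar>"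
    proof -
      have "x *\<^sub>R T u + y *\<^sub>R T v = (y - x) *\<^sub>R T v + x *\<^sub>R (T u + T v)"
        by (simp add: algebra_simps)
      then show ?thesis using comb[of "T v" "T u + T v" "y - x" x] T by metis
    qed
    \<comment> \<open>For coordinates of opposite signs the first sum is
      \<open>\<bar>x - y\<bar>\<close>; for equal signs one of the other two is the larger absolute
      value. The three cases are the cones over the three edges, up to sign.\<close>
    moreover have "\<bar>x\<bar> + \<bar>y\<bar> \<le> ?m x y \<or> \<bar>x - y\<bar> + \<bar>y\<bar> \<le> ?m x y \<or> \<bar>y - x\<bar> + \<bar>x\<bar> \<le> ?m x y"
      by (cases "0 \<le> x"; cases "0 \<le> y"; cases "x \<le> y"; simp add: max_def)
    ultimately show ?thesis by (meson order_trans)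
  qed
  have "norm (T z) \<le> 1 * norm z" for z
    using bound[of "fst (coord z)" "snd (coord z)"] norm_eq[of "fst (coord z)" "snd (coord z)"]
    unfolding coord_expand
    by (metis blinfun.add_right blinfun.scaleR_right coord_expand mult_1)
  then show "norm T \<le> 1" by (intro norm_blinfun_bound) auto
qed

definition operator :: "(real \<times> real) \<times> real \<times> real \<Rightarrow> 'a \<Rightarrow>\<^sub>L 'a" where
  "operator = (\<lambda>((a, b), (c, d)). Blinfun (\<lambda>z.
     fst (coord z) *\<^sub>R (a *\<^sub>R u + b *\<^sub>R v) + snd (coord z) *\<^sub>R (c *\<^sub>R u + d *\<^sub>R v)))"

text \<open>The norm dominates both coordinates. This boundedness is what makes
  \<open>Blinfun\<close> return the intended map in \<open>operator\<close>.\<close>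

lemma bounded_linear_coord:
  "bounded_linear (\<lambda>z. fst (coord z))" "bounded_linear (\<lambda>z. snd (coord z))"
proof -
  have "\<bar>fst (coord z)\<bar> \<le> norm z * 1 \<and> \<bar>snd (coord z)\<bar> \<le> norm z * 1" for z
    using norm_eq[of "fst (coord z)" "snd (coord z)"] by (simp add: coord_expand le_max_iff_disj)
  then show "bounded_linear (\<lambda>z. fst (coord z))" "bounded_linear (\<lambda>z. snd (coord z))"
    using linear_coord by (auto intro!: bounded_linear_intro[where K = 1] simp: linear_add linear_scale)
qed

lemma operator_apply:
  "blinfun_apply (operator ((a, b), (c, d))) z =
    fst (coord z) *\<^sub>R (a *\<^sub>R u + b *\<^sub>R v) + snd (coord z) *\<^sub>R (c *\<^sub>R u + d *\<^sub>R v)"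
  unfolding operator_def
  by (auto intro!: bounded_linear_Blinfun_apply[THEN fun_cong] bounded_linear_add
      bounded_linear_scaleR_const bounded_linear_coord)

lemma operator_basis:
  "blinfun_apply (operator ((a, b), (c, d))) u = a *\<^sub>R u + b *\<^sub>R v"
  "blinfun_apply (operator ((a, b), (c, d))) v = c *\<^sub>R u + d *\<^sub>R v"
  using coord_eq[of 1 0] coord_eq[of 0 1] by (simp_all add: operator_apply)

lemma linear_operator: "linear operator"
proof (rule linearI)
  fix p q :: "(real \<times> real) \<times> real \<times> real" and r :: real
  obtain a b c d a' b' c' d' where "p = ((a, b), (c, d))" "q = ((a', b'), (c', d'))"
    by (metis surj_pair)
  then show "operator (p + q) = operator p + operator q" "operator (r *\<^sub>R p) = r *\<^sub>R operator p"
    by (auto intro!: blinfun_eqI simp: operator_apply blinfun.add_left blinfun.scaleR_left algebra_simps)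
qed

lemma inj_operator: "inj operator"
proof (rule injI)
  fix p q assume eq: "operator p = operator q"
  obtain a b c d a' b' c' d' where pq: "p = ((a, b), (c, d))" "q = ((a', b'), (c', d'))"
    by (metis surj_pair)
  have "a *\<^sub>R u + b *\<^sub>R v = a' *\<^sub>R u + b' *\<^sub>R v" "c *\<^sub>R u + d *\<^sub>R v = c' *\<^sub>R u + d' *\<^sub>R v"
    using eq pq by (metis operator_basis)+
  then show "p = q" using unique pq by blast
qed

lemma surj_operator: "surj operator"
proof (rule surjI)
  fix T :: "'a \<Rightarrow>\<^sub>L 'a"
  have "operator (coord (T u), coord (T v)) z = T z" for z
  proof -
    have "operator (coord (T u), coord (T v)) z = fst (coord z) *\<^sub>R T u + snd (coord z) *\<^sub>R T v"
      using operator_apply[of "fst (coord (T u))" "snd (coord (T u))" "fst (coord (T v))" "snd (coord (T v))" z]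
      by (simp add: coord_expand)
    also have "\<dots> = T z" by (metis blinfun.add_right blinfun.scaleR_right coord_expand)
    finally show ?thesis .
  qed
  then show "operator (coord (T u), coord (T v)) = T" by (rule blinfun_eqI)
qed

text \<open>Each of the three images of \<open>u\<close>, \<open>v\<close> and \<open>u + v\<close>
  must satisfy three coordinate bounds; together these are the nine forms.\<close>

lemma operator_in_cball_iff: "operator p \<in> cball 0 1 \<longleftrightarrow> p \<in> matrix_ball"
proof -
  obtain a b c d where p: "p = ((a, b), (c, d))" by (metis surj_pair)
  have "(a *\<^sub>R u + b *\<^sub>R v) + (c *\<^sub>R u + d *\<^sub>R v) = (a + c) *\<^sub>R u + (b + d) *\<^sub>R v"
    by (simp add: algebra_simps)
  then show ?thesis
    by (auto simp: p norm_blinfun_le_1_iff operator_basis norm_le_1_iff matrix_ball_def entry_forms_def)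
qed

text \<open>The linear bijection \<open>operator\<close> takes \<open>matrix_ball\<close> onto the
  unit ball, and so takes extreme points to extreme points without changing their number.\<close>

lemma card_extreme_points_cball_blinfun:
  "card {T :: 'a \<Rightarrow>\<^sub>L 'a. T extreme_point_of cball 0 1} = 30"
proof -
  have ball: "cball 0 1 = operator ` matrix_ball"
    using surj_operator operator_in_cball_iff by (metis (no_types) vimage_eq surj_image_vimage_eq set_eqI)
  have "{T :: 'a \<Rightarrow>\<^sub>L 'a. T extreme_point_of cball 0 1} =
      operator ` map_prod (map_prod of_int of_int) (map_prod of_int of_int) ` integral_matrices"
    unfolding ball extreme_points_of_linear_image[OF linear_operator inj_operator]
    by (simp add: extreme_points_matrix_ball)
  also have "card \<dots> = card integral_matrices"
    unfolding image_image
    by (intro card_image inj_onI) (auto dest!: injD[OF inj_operator])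
  finally show ?thesis by (simp add: card_integral_matrices)
qed

end

section \<open>From a regular hexagon to a hexagonal basis\<close>

text \<open>The disc of radius \<open>r\<close> around \<open>c\<close> contains the hexagon and, by
  symmetry, the negatives of two opposite vertices. The parallelogram law then leaves no room for a
  nonzero \<open>c\<close>.\<close>

lemma hexagon_centre_eq_0:
  assumes "0 < r" and S: "S = (\<Union>k<6. closed_segment (hexagon_vertex c r t k) (hexagon_vertex c r t (Suc k)))"
    and sym: "\<And>x. x \<in> S \<Longrightarrow> - x \<in> S"
  shows "c = 0"
proof -
  define e where "e k = (vector [cos (t + real k * pi / 3), sin (t + real k * pi / 3)] :: real^2)" for k
  have vertex: "hexagon_vertex c r t k = c + r *\<^sub>R e k" for k
    by (simp add: hexagon_vertex_def e_def)
  have norm_e: "norm (e k) = 1" for k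
    by (simp add: e_def norm_vec_def L2_set_def sum_2)
  have "S \<subseteq> cball c r"
    unfolding S using norm_e \<open>0 < r\<close>
    by (intro UN_least closed_segment_subset) (auto simp: vertex dist_norm)
  have "c + r *\<^sub>R e k \<in> S" if "k < 6" for k
    unfolding S vertex[symmetric] using that by auto
  then have "- (c + r *\<^sub>R e k) \<in> cball c r" if "k < 6" for k
    using that sym \<open>S \<subseteq> cball c r\<close> by blast
  \<comment> \<open>The vertices with indices 0 and 3 are opposite each other.\<close>
  from this[of 0] this[of 3] have "norm (c + (c + r *\<^sub>R e 0)) \<le> r" "norm (c + (c + r *\<^sub>R e 3)) \<le> r"
    by (simp_all add: dist_norm)
  moreover have "e 3 = - e 0"
    by (simp add: e_def vec_eq_iff forall_2)
  ultimately have "(norm (2 *\<^sub>R c + r *\<^sub>R e 0))\<^sup>2 \<le> r\<^sup>2" "(norm (2 *\<^sub>R c - r *\<^sub>R e 0))\<^sup>2 \<le> r\<^sup>2"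
    by (auto intro!: power_mono simp: scaleR_2 algebra_simps)
  moreover have "(norm (2 *\<^sub>R c + r *\<^sub>R e 0))\<^sup>2 + (norm (2 *\<^sub>R c - r *\<^sub>R e 0))\<^sup>2 =
      2 * (norm (2 *\<^sub>R c))\<^sup>2 + 2 * (norm (r *\<^sub>R e 0))\<^sup>2"
    by (simp only: power2_norm_eq_inner) (simp add: algebra_simps inner_commute)
  moreover have "(norm (r *\<^sub>R e 0))\<^sup>2 = r\<^sup>2" using norm_e by simp
  ultimately have "(norm (2 *\<^sub>R c))\<^sup>2 \<le> 0" by linarith
  then show ?thesis by simp
qed

text \<open>The preimages of the vertices 0 and 2 form the basis, because vertex 1 is then the sum
  of the two. The sphere fixes the norm by homogeneity.\<close>

lemma hexagonal_basis_exists: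
  fixes \<phi> :: "'a::real_normed_vector \<Rightarrow> real^2"
  assumes lin: "linear \<phi>" and bij: "bij \<phi>" and hex: "regular_hexagon (\<phi> ` sphere 0 1)"
  shows "\<exists>u v :: 'a. hexagonal_basis u v"
proof -
  obtain c r t where "0 < r" and S: "\<phi> ` sphere 0 1 =
      (\<Union>k<6. closed_segment (hexagon_vertex c r t k) (hexagon_vertex c r t (Suc k)))"
    using hex unfolding regular_hexagon_def by blast
  have "- x \<in> \<phi> ` sphere 0 1" if "x \<in> \<phi> ` sphere 0 1" for x
  proof -
    from that obtain w where "x = \<phi> w" "w \<in> sphere 0 1" by (rule imageE)
    then show ?thesis by (intro image_eqI[of _ _ "- w"]) (simp_all add: linear_neg[OF lin])
  qed
  then have "c = 0" by (rule hexagon_centre_eq_0[OF \<open>0 < r\<close> S])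
  define P where "P = hexagon_vertex 0 r t 0"
  define Q where "Q = hexagon_vertex 0 r t 2"
  \<comment> \<open>About the centre 0, this is the identity cos (y + pi/3) + cos (y - pi/3) = cos y
    and its analogue for the sine.\<close>
  have step: "hexagon_vertex 0 r t (Suc (Suc k)) = hexagon_vertex 0 r t (Suc k) - hexagon_vertex 0 r t k" for k
  proof -
    define y where "y = t + real (Suc k) * pi / 3"
    have angles: "t + real k * pi / 3 = y - pi / 3" "t + real (Suc (Suc k)) * pi / 3 = y + pi / 3"
      by (simp_all add: y_def field_simps)
    have "cos (y + pi / 3) = cos y - cos (y - pi / 3)" "sin (y + pi / 3) = sin y - sin (y - pi / 3)"
      by (simp_all add: cos_add cos_diff sin_add sin_diff cos_60)
    then show ?thesis
      unfolding hexagon_vertex_def angles y_def[symmetric]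
      by (simp add: vec_eq_iff forall_2 right_diff_distrib)
  qed
  have verts: "hexagon_vertex 0 r t 1 = P + Q" "hexagon_vertex 0 r t 3 = - P"
      "hexagon_vertex 0 r t 4 = - P - Q" "hexagon_vertex 0 r t 5 = - Q" "hexagon_vertex 0 r t 6 = P"
    using step[of 0] step[of 1] step[of 2] step[of 3] step[of 4]
    by (simp_all add: P_def Q_def eval_nat_numeral)
  have hexagon: "\<phi> ` sphere 0 1 = closed_segment P (P + Q) \<union> closed_segment (P + Q) Q \<union> closed_segment Q (- P)
      \<union> closed_segment (- P) (- P - Q) \<union> closed_segment (- P - Q) (- Q) \<union> closed_segment (- Q) P"
    unfolding S \<open>c = 0\<close> using verts
    by (auto simp: P_def Q_def eval_nat_numeral lessThan_Suc)
  have inner: "hexagon_vertex 0 r t j \<bullet> hexagon_vertex 0 r t k = r\<^sup>2 * cos (real k * pi / 3 - real j * pi / 3)" for j k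
  proof -
    have "cos (real k * pi / 3 - real j * pi / 3) =
        cos (t + real j * pi / 3) * cos (t + real k * pi / 3) + sin (t + real j * pi / 3) * sin (t + real k * pi / 3)"
      using cos_diff[of "t + real k * pi / 3" "t + real j * pi / 3"] by (simp add: mult.commute)
    then show ?thesis
      by (simp add: hexagon_vertex_def inner_vec_def sum_2 power2_eq_square ring_distribs)
  qed
  have PQ: "P \<bullet> P = r\<^sup>2" "Q \<bullet> Q = r\<^sup>2" "P \<bullet> Q = - r\<^sup>2 / 2"
    unfolding P_def Q_def inner by (simp_all add: cos_120)
  have indep: "x = 0 \<and> y = 0" if "x *\<^sub>R P + y *\<^sub>R Q = 0" for x y
  proof -
    have "0 = (x *\<^sub>R P + y *\<^sub>R Q) \<bullet> (x *\<^sub>R P + y *\<^sub>R Q)" using that by simp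
    also have "\<dots> = r\<^sup>2 * (x\<^sup>2 - x * y + y\<^sup>2)"
      by (simp add: inner_add PQ inner_commute[of Q P] power2_eq_square algebra_simps)
    finally have "x\<^sup>2 - x * y + y\<^sup>2 = 0" using \<open>0 < r\<close> by simp
    \<comment> \<open>Doubling the quadratic form exhibits it as a sum of squares.\<close>
    then have "x\<^sup>2 + y\<^sup>2 + (x - y)\<^sup>2 = 0" by (simp add: power2_eq_square algebra_simps)
    then show ?thesis by (metis add_nonneg_eq_0_iff zero_le_power2 sum_power2_ge_zero sum_power2_eq_zero_iff)
  qed
  let ?g = "\<lambda>x y :: real. max (max \<bar>x\<bar> \<bar>y\<bar>) \<bar>x - y\<bar>"
  define u where "u = inv \<phi> P"
  define v where "v = inv \<phi> Q"
  have \<phi>_comb: "\<phi> (x *\<^sub>R u + y *\<^sub>R v) = x *\<^sub>R P + y *\<^sub>R Q" for x y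
    using bij by (simp add: u_def v_def linear_add[OF lin] linear_scale[OF lin] bij_is_surj surj_f_inv_f)
  have sphere: "\<exists>x y. z = x *\<^sub>R u + y *\<^sub>R v \<and> ?g x y = 1" if "norm z = 1" for z
  proof -
    have "\<phi> z \<in> \<phi> ` sphere 0 1" using that by simp
    \<comment> \<open>On each of the six edges one of \<open>x\<close>, \<open>y\<close>,
      \<open>x - y\<close> is constantly 1 or -1, and the other two are bounded by 1 in absolute
      value.\<close>
    then have "\<exists>x y. \<phi> z = x *\<^sub>R P + y *\<^sub>R Q \<and> ?g x y = 1"
      unfolding hexagon Un_iff in_segment
    proof (elim disjE exE conjE)
      fix s :: real assume s: "0 \<le> s" "s \<le> 1"
      show ?thesis if "\<phi> z = (1 - s) *\<^sub>R P + s *\<^sub>R (P + Q)"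
        using that s by (intro exI[of _ 1] exI[of _ s]) (auto simp: algebra_simps)
      show ?thesis if "\<phi> z = (1 - s) *\<^sub>R (P + Q) + s *\<^sub>R Q"
        using that s by (intro exI[of _ "1 - s"] exI[of _ 1]) (auto simp: algebra_simps)
      show ?thesis if "\<phi> z = (1 - s) *\<^sub>R Q + s *\<^sub>R (- P)"
        using that s by (intro exI[of _ "- s"] exI[of _ "1 - s"]) (auto simp: algebra_simps)
      show ?thesis if "\<phi> z = (1 - s) *\<^sub>R (- P) + s *\<^sub>R (- P - Q)"
        using that s by (intro exI[of _ "- 1"] exI[of _ "- s"]) (auto simp: algebra_simps)
      show ?thesis if "\<phi> z = (1 - s) *\<^sub>R (- P - Q) + s *\<^sub>R (- Q)"
        using that s by (intro exI[of _ "s - 1"] exI[of _ "- 1"]) (auto simp: algebra_simps)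
      show ?thesis if "\<phi> z = (1 - s) *\<^sub>R (- Q) + s *\<^sub>R P"
        using that s by (intro exI[of _ s] exI[of _ "s - 1"]) (auto simp: algebra_simps)
    qed
    then show ?thesis using \<phi>_comb bij by (metis bij_is_inj injD)
  qed
  have rep: "\<exists>x y. z = x *\<^sub>R u + y *\<^sub>R v \<and> norm z = ?g x y" for z
  proof (cases "z = 0")
    case True
    then show ?thesis by (intro exI[of _ 0]) auto
  next
    case False
    then obtain x y where xy: "sgn z = x *\<^sub>R u + y *\<^sub>R v" "?g x y = 1"
      using sphere[of "sgn z"] by (auto simp: norm_sgn)
    have "z = norm z *\<^sub>R sgn z" using False by (simp add: sgn_div_norm)
    then have "z = (norm z * x) *\<^sub>R u + (norm z * y) *\<^sub>R v" unfolding xy(1) by (simp add: algebra_simps)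
    moreover have "?g (norm z * x) (norm z * y) = norm z * ?g x y"
      by (simp add: abs_mult max_mult_distrib_left flip: right_diff_distrib)
    ultimately show ?thesis using xy(2) by (metis mult.right_neutral)
  qed
  have "hexagonal_basis u v"
  proof
    show "\<exists>x y. z = x *\<^sub>R u + y *\<^sub>R v" for z using rep by blast
    show "norm (x *\<^sub>R u + y *\<^sub>R v) = ?g x y" for x y
    proof -
      \<comment> \<open>The coordinates supplied by \<open>rep\<close> are identified with the given
        ones through the independence of \<open>P\<close> and \<open>Q\<close>.\<close>
      obtain x' y' where xy': "x *\<^sub>R u + y *\<^sub>R v = x' *\<^sub>R u + y' *\<^sub>R v" "norm (x *\<^sub>R u + y *\<^sub>R v) = ?g x' y'"
        using rep by blast
      then have "x *\<^sub>R P + y *\<^sub>R Q = x' *\<^sub>R P + y' *\<^sub>R Q" using \<phi>_comb by metis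
      then have "(x - x') *\<^sub>R P + (y - y') *\<^sub>R Q = 0" by (simp add: algebra_simps)
      then show ?thesis using indep[of "x - x'" "y - y'"] xy'(2) by simp
    qed
  qed
  then show ?thesis by blast
qed

theorem theorem2p16:
  fixes \<phi> :: "'a::banach \<Rightarrow> real^2"
  assumes "polygonal TYPE('a)"
    and "linear \<phi>" and "bij \<phi>"
    and "regular_hexagon (\<phi> ` sphere 0 1)"
  shows "card {T :: 'a \<Rightarrow>\<^sub>L 'a. T extreme_point_of cball 0 1} = 30"
proof -
  obtain u v :: 'a where "hexagonal_basis u v"
    using hexagonal_basis_exists assms by blast
  then show ?thesis by (rule hexagonal_basis.card_extreme_points_cball_blinfun)
qed

end
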